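(* Let $\mathbb{T}$ be the unit circle in $\mathbb{C}$ with normalized Lebesgue measure $\mu$, and let $\varphi\in L^\infty(\mathbb{T})$. Let $M_\varphi$ be the multiplication operator $M_\varphi f=\varphi f$ on $L^2(\mathbb{T})$. Then the following are equivalent: (i) $M_\varphi\in\mathcal{M}_r(L^2(\mathbb{T}))$; (ii) there exist a countable set $\Lambda\subseteq[0,\|\varphi\|_\infty]$, well-ordered by the usual order of $\mathbb{R}$, a family $\{E_\lambda\}_{\lambda\in\Lambda}$ of pairwise essentially disjoint measurable subsets of $\mathbb{T}$ with $\mu(E_\lambda)>0$ for every $\lambda\in\Lambda$ and $\mu\left(\mathbb{T}\setminus\bigcup_{\lambda\in\Lambda}E_\lambda\right)=0$, and a function $\omega\in L^\infty(\mathbb{T})$ with $|\omega|=1$ a.e. on $\mathbb{T}$, such that $$\varphi=\omega\sum_{\lambda\in\Lambda}\lambda\chi_{E_\lambda}\quad\text{a.e. on }\mathbb{T}.$$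
   Context: Sets $E,F$ are essentially disjoint if $\mu(E\cap F)=0$; $\chi_E$ is the indicator function of $E$. For a Hilbert space $H$, $\mathcal{B}(H)$ denotes the bounded linear operators on $H$. For a nonzero Hilbert space $M$ and $A\in\mathcal{B}(M)$, the minimum modulus is $m(A)=\inf\{\|Ax\|: x\in M,\ \|x\|=1\}$; $A$ is minimum attaining if there is a unit vector $x_0\in M$ with $\|Ax_0\|=m(A)$. A closed subspace $M\subseteq H$ reduces $T\in\mathcal{B}(H)$ if $T(M)\subseteq M$ and $T^*(M)\subseteq M$. $\mathcal{M}_r(H)$ is the set of all $T\in\mathcal{B}(H)$ such that for every nonzero closed subspace $M$ reducing $T$, the restriction $T|_M:M\to M$ is minimum attaining. *)

theory Defs
  imports "HOL-Probability.Probability"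
begin

section \<open>Complex Hilbert spaces\<close>

class cinner_space = real_inner +
  fixes scaleC :: "complex \<Rightarrow> 'a \<Rightarrow> 'a"  (infixr \<open>*\<^sub>C\<close> 75)
    and cinner :: "'a \<Rightarrow> 'a \<Rightarrow> complex"
  assumes scaleC_add_right: "a *\<^sub>C (x + y) = a *\<^sub>C x + a *\<^sub>C y"
    and scaleC_add_left: "(a + b) *\<^sub>C x = a *\<^sub>C x + b *\<^sub>C x"
    and scaleC_scaleC: "a *\<^sub>C b *\<^sub>C x = (a * b) *\<^sub>C x"
    and scaleC_one: "1 *\<^sub>C x = x"
    and scaleR_scaleC: "r *\<^sub>R x = complex_of_real r *\<^sub>C x"
    and cinner_commute: "cinner x y = cnj (cinner y x)"
    and cinner_add_left: "cinner (x + y) z = cinner x z + cinner y z"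
    and cinner_scaleC_left: "cinner (a *\<^sub>C x) y = a * cinner x y"
    and inner_eq_Re_cinner: "x \<bullet> y = Re (cinner x y)"
begin

lemma cinner_self: "cinner x x = complex_of_real ((norm x)\<^sup>2)"
proof -
  have "Im (cinner x x) = 0"
    using cinner_commute[of x x] by (simp add: complex_eq_iff)
  then show ?thesis
    by (simp add: complex_eq_iff power2_norm_eq_inner inner_eq_Re_cinner)
qed

end

class chilbert_space = cinner_space + complete_space

definition bounded_clinear :: "('a::cinner_space \<Rightarrow> 'b::cinner_space) \<Rightarrow> bool" where
  "bounded_clinear T \<longleftrightarrow>
     (\<forall>x y. T (x + y) = T x + T y) \<and> (\<forall>a x. T (a *\<^sub>C x) = a *\<^sub>C T x) \<and>
     (\<exists>K. \<forall>x. norm (T x) \<le> K * norm x)"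

definition csubspace :: "'a::cinner_space set \<Rightarrow> bool" where
  "csubspace M \<longleftrightarrow> 0 \<in> M \<and> (\<forall>x\<in>M. \<forall>y\<in>M. x + y \<in> M) \<and> (\<forall>a. \<forall>x\<in>M. a *\<^sub>C x \<in> M)"

text \<open>For bounded \<open>T\<close> the adjoint exists (Riesz representation) and is unique, so the description
  is proper.\<close>

definition cadjoint :: "('a::chilbert_space \<Rightarrow> 'a) \<Rightarrow> 'a \<Rightarrow> 'a" where
  "cadjoint T = (THE S. \<forall>x y. cinner (T x) y = cinner x (S y))"

lemma cadjoint_eqI:
  assumes "\<And>x y. cinner (T x) y = cinner x (S y)"
  shows "cadjoint T = S"
  unfolding cadjoint_def
proof (rule the_equality)
  fix S' assume S': "\<forall>x y. cinner (T x) y = cinner x (S' y)"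
  show "S' = S"
  proof
    fix y
    have "x \<bullet> S' y = x \<bullet> S y" for x
      using S' assms by (metis inner_eq_Re_cinner)
    then have "(S' y - S y) \<bullet> (S' y - S y) = 0"
      by (simp add: inner_diff_right)
    then show "S' y = S y"
      by simp
  qed
qed (use assms in blast)

definition reduces :: "'a::chilbert_space set \<Rightarrow> ('a \<Rightarrow> 'a) \<Rightarrow> bool" where
  "reduces M T \<longleftrightarrow> T ` M \<subseteq> M \<and> cadjoint T ` M \<subseteq> M"

text \<open>An operator on a closed subspace \<open>M\<close> is represented by any map on the ambient space that
  agrees with it on \<open>M\<close>; in particular the restriction of \<open>T\<close> to an invariant \<open>M\<close> is the pair
  of \<open>M\<close> and \<open>T\<close>. The set over which the infimum is taken is nonempty when \<open>M\<close> is nonzero.\<close>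

definition min_modulus_on :: "'a::chilbert_space set \<Rightarrow> ('a \<Rightarrow> 'a) \<Rightarrow> real" where
  "min_modulus_on M A = Inf {norm (A x) | x. x \<in> M \<and> norm x = 1}"

definition min_attaining_on :: "'a::chilbert_space set \<Rightarrow> ('a \<Rightarrow> 'a) \<Rightarrow> bool" where
  "min_attaining_on M A \<longleftrightarrow> (\<exists>x\<in>M. norm x = 1 \<and> norm (A x) = min_modulus_on M A)"

definition reducing_min_attaining :: "('a::chilbert_space \<Rightarrow> 'a) set" (\<open>\<M>\<^sub>r\<close>) where
  "\<M>\<^sub>r = {T. bounded_clinear T \<and>
     (\<forall>M. csubspace M \<and> closed M \<and> M \<noteq> {0} \<and> reduces M T \<longrightarrow> min_attaining_on M T)}"


section \<open>Normalized Lebesgue measure on the unit circle\<close>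

text \<open>The pushforward of the uniform distribution on \<open>[0, 2\<pi>)\<close> under \<open>cis\<close>, completed so that
  all Lebesgue measurable sets are included.\<close>

definition circle :: "complex measure" where
  "circle = completion
     (distr (uniform_measure lborel {0..<2 * pi}) (restrict_space borel (sphere 0 1)) cis)"

lemma cis_measurable_circle: "cis \<in> borel \<rightarrow>\<^sub>M restrict_space borel (sphere 0 1)"
  by (rule measurable_restrict_space2)
     (auto intro!: borel_measurable_continuous_onI continuous_intros)

lemma space_circle: "space circle = sphere 0 1"
  by (simp add: circle_def space_restrict_space)

lemma prob_space_circle: "prob_space circle"
proof -
  have "prob_space (uniform_measure lborel {0..<2 * pi})"
    by (rule prob_space_uniform_measure) auto
  then have "prob_space
      (distr (uniform_measure lborel {0..<2 * pi}) (restrict_space borel (sphere 0 1)) cis)"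
    by (rule prob_space.prob_space_distr) (use cis_measurable_circle in simp)
  then show ?thesis
    unfolding circle_def by (rule prob_space.prob_space_completion)
qed

definition essentially_disjoint :: "complex set \<Rightarrow> complex set \<Rightarrow> bool" where
  "essentially_disjoint E F \<longleftrightarrow> emeasure circle (E \<inter> F) = 0"

text \<open>Elements of \<open>L\<^sup>\<infinity>\<close> are given by representatives; \<open>esssup\<close> is \<open>\<infinity>\<close> on functions that are not
  essentially bounded.\<close>

definition Linf :: "(complex \<Rightarrow> complex) set" where
  "Linf = {f \<in> borel_measurable circle. esssup circle (\<lambda>z. ereal (cmod (f z))) < \<infinity>}"

definition Linf_norm :: "(complex \<Rightarrow> complex) \<Rightarrow> real" where
  "Linf_norm f = real_of_ereal (esssup circle (\<lambda>z. ereal (cmod (f z))))"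

lemma Linf_AE_le: "f \<in> Linf \<Longrightarrow> AE z in circle. cmod (f z) \<le> Linf_norm f"
  using esssup_AE[of "\<lambda>z. ereal (cmod (f z))" circle]
  by (cases "esssup circle (\<lambda>z. ereal (cmod (f z)))") (auto simp: Linf_def Linf_norm_def)


section \<open>The Hilbert space \<open>L\<^sup>2\<close> of the circle\<close>

definition sq_int :: "(complex \<Rightarrow> complex) \<Rightarrow> bool" where
  "sq_int f \<longleftrightarrow> f \<in> borel_measurable circle \<and> integrable circle (\<lambda>z. (cmod (f z))\<^sup>2)"

lemma sq_int_add:
  assumes "sq_int f" "sq_int g"
  shows "sq_int (\<lambda>z. f z + g z)"
proof -
  have [measurable]: "f \<in> borel_measurable circle" "g \<in> borel_measurable circle"
    using assms by (auto simp: sq_int_def)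
  have "(cmod (a + b))\<^sup>2 \<le> 2 * (cmod a)\<^sup>2 + 2 * (cmod b)\<^sup>2" for a b
  proof -
    have "(cmod (a + b))\<^sup>2 \<le> (cmod a + cmod b)\<^sup>2"
      by (intro power_mono norm_triangle_ineq) auto
    also have "\<dots> \<le> 2 * (cmod a)\<^sup>2 + 2 * (cmod b)\<^sup>2"
      using zero_le_power2[of "cmod a - cmod b"] by (simp add: power2_eq_square algebra_simps)
    finally show ?thesis .
  qed
  then have bound: "norm ((cmod (f z + g z))\<^sup>2) \<le> norm (2 * (cmod (f z))\<^sup>2 + 2 * (cmod (g z))\<^sup>2)" for z
    by simp
  have "integrable circle (\<lambda>z. 2 * (cmod (f z))\<^sup>2 + 2 * (cmod (g z))\<^sup>2)"
    using assms by (simp add: sq_int_def)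
  then have "integrable circle (\<lambda>z. (cmod (f z + g z))\<^sup>2)"
    by (rule Bochner_Integration.integrable_bound) (use bound in auto)
  then show ?thesis by (simp add: sq_int_def)
qed

lemma sq_int_mult_bounded:
  assumes "sq_int f" "h \<in> borel_measurable circle" "AE z in circle. cmod (h z) \<le> C"
  shows "sq_int (\<lambda>z. h z * f z)"
proof -
  have [measurable]: "f \<in> borel_measurable circle" "h \<in> borel_measurable circle"
    using assms by (auto simp: sq_int_def)
  have "integrable circle (\<lambda>z. (cmod (h z * f z))\<^sup>2)"
  proof (rule Bochner_Integration.integrable_bound[where f = "\<lambda>z. C\<^sup>2 * (cmod (f z))\<^sup>2"])
    show "AE z in circle. norm ((cmod (h z * f z))\<^sup>2) \<le> norm (C\<^sup>2 * (cmod (f z))\<^sup>2)"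
      using assms(3)
      by eventually_elim
         (auto simp: norm_mult power_mult_distrib intro!: mult_right_mono power_mono)
  qed (use assms in \<open>auto simp: sq_int_def\<close>)
  then show ?thesis by (simp add: sq_int_def)
qed

lemma sq_int_scale: "sq_int f \<Longrightarrow> sq_int (\<lambda>z. c * f z)"
  by (rule sq_int_mult_bounded[where C = "cmod c"]) auto

lemma sq_int_zero: "sq_int (\<lambda>_. 0)"
  by (simp add: sq_int_def)

lemma sq_int_uminus: "sq_int f \<Longrightarrow> sq_int (\<lambda>z. - f z)"
  by (simp add: sq_int_def)

lemma sq_int_diff: "sq_int f \<Longrightarrow> sq_int g \<Longrightarrow> sq_int (\<lambda>z. f z - g z)"
  using sq_int_add[of f "\<lambda>z. - g z"] sq_int_uminus[of g] by simp

lemma cnj_measurable [measurable]: "cnj \<in> borel_measurable borel"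
  by (intro borel_measurable_continuous_onI continuous_intros)

lemma sq_int_integrable_mult:
  assumes "sq_int f" "sq_int g"
  shows "integrable circle (\<lambda>z. f z * cnj (g z))"
proof (rule Bochner_Integration.integrable_bound
    [where f = "\<lambda>z. (cmod (f z))\<^sup>2 + (cmod (g z))\<^sup>2"])
  have [measurable]: "f \<in> borel_measurable circle" "g \<in> borel_measurable circle"
    using assms by (auto simp: sq_int_def)
  show "(\<lambda>z. f z * cnj (g z)) \<in> borel_measurable circle"
    by measurable
  have "cmod a * cmod b \<le> (cmod a)\<^sup>2 + (cmod b)\<^sup>2" for a b
  proof -
    have "2 * cmod a * cmod b \<le> (cmod a)\<^sup>2 + (cmod b)\<^sup>2" "0 \<le> cmod a * cmod b"
      by (rule sum_squares_bound) simp
    then show ?thesis by linarith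
  qed
  then show "AE z in circle. norm (f z * cnj (g z)) \<le> norm ((cmod (f z))\<^sup>2 + (cmod (g z))\<^sup>2)"
    by (auto simp: norm_mult)
qed (use assms in \<open>auto simp: sq_int_def\<close>)

definition L2_rel :: "(complex \<Rightarrow> complex) \<Rightarrow> (complex \<Rightarrow> complex) \<Rightarrow> bool" where
  "L2_rel f g \<longleftrightarrow> sq_int f \<and> sq_int g \<and> (AE z in circle. f z = g z)"

lemma L2_rel_refl_iff: "L2_rel f f \<longleftrightarrow> sq_int f"
  by (simp add: L2_rel_def)

lemma part_equivp_L2_rel: "part_equivp L2_rel"
proof (rule part_equivpI)
  show "\<exists>f. L2_rel f f"
    using sq_int_zero by (auto simp: L2_rel_def)
  show "symp L2_rel"
    by (auto simp: symp_def L2_rel_def eq_commute)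
  show "transp L2_rel"
    unfolding transp_def L2_rel_def by (auto elim: AE_mp)
qed

quotient_type L2 = "complex \<Rightarrow> complex" / partial: L2_rel
  by (rule part_equivp_L2_rel)

lemma Domainp_pcr_L2 [transfer_domain_rule]: "Domainp pcr_L2 = sq_int"
  by (simp add: L2.domain_eq L2_rel_refl_iff fun_eq_iff)

instantiation L2 :: cinner_space
begin

lift_definition zero_L2 :: L2 is "\<lambda>_. 0"
  by (simp add: L2_rel_def sq_int_zero)

lift_definition plus_L2 :: "L2 \<Rightarrow> L2 \<Rightarrow> L2" is "\<lambda>f g z. f z + g z"
  by (auto simp: L2_rel_def intro: sq_int_add)

lift_definition minus_L2 :: "L2 \<Rightarrow> L2 \<Rightarrow> L2" is "\<lambda>f g z. f z - g z"
  by (auto simp: L2_rel_def intro: sq_int_diff)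

lift_definition uminus_L2 :: "L2 \<Rightarrow> L2" is "\<lambda>f z. - f z"
  by (auto simp: L2_rel_def intro: sq_int_uminus)

lift_definition scaleC_L2 :: "complex \<Rightarrow> L2 \<Rightarrow> L2" is "\<lambda>c f z. c * f z"
  by (auto simp: L2_rel_def intro: sq_int_scale)

lift_definition cinner_L2 :: "L2 \<Rightarrow> L2 \<Rightarrow> complex" is "\<lambda>f g. \<integral>z. f z * cnj (g z) \<partial>circle"
proof -
  fix f f' g g' assume *: "L2_rel f f'" "L2_rel g g'"
  then have [measurable]: "f \<in> borel_measurable circle" "f' \<in> borel_measurable circle"
    "g \<in> borel_measurable circle" "g' \<in> borel_measurable circle"
    by (auto simp: sq_int_def L2_rel_def)
  show "(\<integral>z. f z * cnj (g z) \<partial>circle) = (\<integral>z. f' z * cnj (g' z) \<partial>circle)"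
  proof (rule integral_cong_AE)
    have "AE z in circle. f z = f' z" "AE z in circle. g z = g' z"
      using * by (simp_all add: L2_rel_def)
    then show "AE z in circle. f z * cnj (g z) = f' z * cnj (g' z)"
      by eventually_elim simp
  qed measurable
qed

definition scaleR_L2 :: "real \<Rightarrow> L2 \<Rightarrow> L2" where
  "scaleR_L2 r f = complex_of_real r *\<^sub>C f"

definition inner_L2 :: "L2 \<Rightarrow> L2 \<Rightarrow> real" where
  "inner_L2 f g = Re (cinner f g)"

definition norm_L2 :: "L2 \<Rightarrow> real" where
  "norm_L2 f = sqrt (inner f f)"

definition sgn_L2 :: "L2 \<Rightarrow> L2" where
  "sgn_L2 f = inverse (norm f) *\<^sub>R f"

definition dist_L2 :: "L2 \<Rightarrow> L2 \<Rightarrow> real" where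
  "dist_L2 f g = norm (f - g)"

definition uniformity_L2 :: "(L2 \<times> L2) filter" where
  "uniformity_L2 = (INF e\<in>{0<..}. principal {(f, g). dist f g < e})"

definition open_L2 :: "L2 set \<Rightarrow> bool" where
  "open_L2 U \<longleftrightarrow> (\<forall>f\<in>U. \<forall>\<^sub>F (f', g) in uniformity. f' = f \<longrightarrow> g \<in> U)"

instance
proof
  fix f g h :: L2 and a b :: complex and r s :: real
  have integral_self: "(\<integral>z. F z * cnj (F z) \<partial>circle) = of_real (\<integral>z. (cmod (F z))\<^sup>2 \<partial>circle)" for F
    by (simp add: complex_norm_square[symmetric] del: of_real_power)
  show C_right: "a *\<^sub>C (f + g) = a *\<^sub>C f + a *\<^sub>C g" for a and f g :: L2
    by transfer (auto simp: L2_rel_def algebra_simps intro!: sq_int_add sq_int_scale)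
  show C_left: "(a + b) *\<^sub>C f = a *\<^sub>C f + b *\<^sub>C f" for a b and f :: L2
    by transfer (auto simp: L2_rel_def algebra_simps intro!: sq_int_add sq_int_scale)
  show C_assoc: "a *\<^sub>C b *\<^sub>C f = (a * b) *\<^sub>C f" for a b and f :: L2
    by transfer (auto simp: L2_rel_def algebra_simps intro!: sq_int_scale)
  show C_one: "1 *\<^sub>C f = f" for f :: L2
    by transfer (auto simp: L2_rel_def)
  show R_C: "r *\<^sub>R f = complex_of_real r *\<^sub>C f" for r and f :: L2
    by (rule scaleR_L2_def)
  show commute: "cinner f g = cnj (cinner g f)" for f g :: L2
  proof transfer
    fix F G
    have "cnj (\<integral>z. G z * cnj (F z) \<partial>circle) = (\<integral>z. cnj (G z * cnj (F z)) \<partial>circle)"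
      by (rule Bochner_Integration.integral_cnj[symmetric])
    then show "(\<integral>z. F z * cnj (G z) \<partial>circle) = cnj (\<integral>z. G z * cnj (F z) \<partial>circle)"
      by (simp add: mult.commute)
  qed
  show add: "cinner (f + g) h = cinner f h + cinner g h" for f g h :: L2
    by transfer (simp add: distrib_right sq_int_integrable_mult)
  show scale: "cinner (a *\<^sub>C f) g = a * cinner f g" for a and f g :: L2
    by transfer (simp add: mult.assoc)
  show "f \<bullet> g = Re (cinner f g)" for f g :: L2
    by (rule inner_L2_def)
  show "f + g + h = f + (g + h)"
    by transfer (auto simp: L2_rel_def algebra_simps intro!: sq_int_add)
  show "f + g = g + f"
    by transfer (auto simp: L2_rel_def algebra_simps intro!: sq_int_add)
  show "0 + f = f"
    by transfer (auto simp: L2_rel_def)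
  show "- f + f = 0"
    by transfer (auto simp: L2_rel_def sq_int_zero)
  show "f - g = f + - g"
    by transfer (auto simp: L2_rel_def intro!: sq_int_diff)
  show "r *\<^sub>R (f + g) = r *\<^sub>R f + r *\<^sub>R g"
    by (simp add: R_C C_right)
  show "(r + s) *\<^sub>R f = r *\<^sub>R f + s *\<^sub>R f"
    by (simp add: R_C C_left)
  show "r *\<^sub>R s *\<^sub>R f = (r * s) *\<^sub>R f"
    by (simp add: R_C C_assoc)
  show "1 *\<^sub>R f = f"
    by (simp add: R_C C_one)
  show "sgn f = inverse (norm f) *\<^sub>R f"
    by (rule sgn_L2_def)
  show "dist f g = norm (f - g)"
    by (rule dist_L2_def)
  show "uniformity = (INF e\<in>{0<..}. principal {(f :: L2, g). dist f g < e})"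
    by (rule uniformity_L2_def)
  show "open U \<longleftrightarrow> (\<forall>f\<in>U. \<forall>\<^sub>F (f', g) in uniformity. f' = f \<longrightarrow> g \<in> U)" for U :: "L2 set"
    by (rule open_L2_def)
  show "f \<bullet> g = g \<bullet> f"
    by (metis commute cnj.simps(1) inner_L2_def)
  show "(f + g) \<bullet> h = f \<bullet> h + g \<bullet> h"
    by (simp add: inner_L2_def add)
  show "(r *\<^sub>R f) \<bullet> g = r * (f \<bullet> g)"
    by (simp add: inner_L2_def R_C scale)
  show "0 \<le> f \<bullet> f"
    unfolding inner_L2_def by transfer (simp add: integral_self)
  show "f \<bullet> f = 0 \<longleftrightarrow> f = 0"
    unfolding inner_L2_def
  proof transfer
    fix F assume F: "sq_int F"
    then have "Re (\<integral>z. F z * cnj (F z) \<partial>circle) = 0 \<longleftrightarrow> (AE z in circle. (cmod (F z))\<^sup>2 = 0)"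
      by (simp add: integral_self sq_int_def integral_nonneg_eq_0_iff_AE)
    then show "Re (\<integral>z. F z * cnj (F z) \<partial>circle) = 0 \<longleftrightarrow> L2_rel F (\<lambda>_. 0)"
      using F by (simp add: L2_rel_def sq_int_zero)
  qed
  show "norm f = sqrt (f \<bullet> f)"
    by (rule norm_L2_def)
qed

end

lemma norm_abs_L2:
  assumes "sq_int f"
  shows "(norm (abs_L2 f))\<^sup>2 = (\<integral>z. (cmod (f z))\<^sup>2 \<partial>circle)"
proof -
  have "(norm (abs_L2 f))\<^sup>2 = Re (\<integral>z. f z * cnj (f z) \<partial>circle)"
    using assms by (simp add: power2_norm_eq_inner inner_L2_def cinner_L2.abs_eq L2_rel_refl_iff)
  also have "\<dots> = (\<integral>z. (cmod (f z))\<^sup>2 \<partial>circle)"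
    by (simp add: complex_norm_square[symmetric] del: of_real_power)
  finally show ?thesis .
qed

lemma abs_L2_diff: "sq_int f \<Longrightarrow> sq_int g \<Longrightarrow> abs_L2 f - abs_L2 g = abs_L2 (\<lambda>z. f z - g z)"
  by (simp add: minus_L2.abs_eq L2_rel_refl_iff)

lemma sq_int_rep_L2: "sq_int (rep_L2 x)"
  using Quotient_rep_reflp[OF Quotient_L2, of x] by (simp add: L2_rel_refl_iff)

lemma abs_rep_L2: "abs_L2 (rep_L2 x) = x"
  by (rule Quotient_abs_rep[OF Quotient_L2])

instance L2 :: chilbert_space
proof
  fix X :: "nat \<Rightarrow> L2" assume "Cauchy X"
  define F where "F n = rep_L2 (X n)" for n
  have F: "sq_int (F n)" "X n = abs_L2 (F n)" for n
    by (simp_all add: F_def sq_int_rep_L2 abs_rep_L2)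
  have [measurable]: "F n \<in> borel_measurable circle" for n
    using F(1)[of n] by (simp add: sq_int_def)
  have nn: "(\<integral>\<^sup>+z. ennreal ((cmod (F m z - F n z))\<^sup>2) \<partial>circle) = ennreal ((dist (X m) (X n))\<^sup>2)" for m n
    using sq_int_diff[OF F(1) F(1), of m n]
    by (subst nn_integral_eq_integral)
       (auto simp: sq_int_def dist_norm F(2) abs_L2_diff[OF F(1) F(1)]
           norm_abs_L2[OF sq_int_diff[OF F(1) F(1)]])
  have "\<exists>N. \<forall>m\<ge>N. \<forall>k\<ge>N. dist (X m) (X k) < (1/2) ^ n" for n :: nat
    using \<open>Cauchy X\<close> by (auto simp: Cauchy_def)
  then obtain N where N: "\<And>n m k. m \<ge> N n \<Longrightarrow> k \<ge> N n \<Longrightarrow> dist (X m) (X k) < (1/2) ^ n"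
    by metis
  define r where "r n = (\<Sum>i\<le>n. N i) + n" for n
  have r_mono: "strict_mono r"
    by (rule strict_mono_Suc_iff[THEN iffD2]) (auto simp: r_def)
  have r_N: "m \<ge> n \<Longrightarrow> r m \<ge> N n" for m n
    using member_le_sum[of n "{..m}" N] by (simp add: r_def)
  have close: "dist (X (r m)) (X (r n)) < (1/2) ^ n" if "m \<ge> n" for m n
    using that by (intro N r_N) auto

  define d where "d n z = F (r (Suc n)) z - F (r n) z" for n z
  have [measurable]: "d n \<in> borel_measurable circle" for n
    unfolding d_def by measurable
  have d_le: "(\<integral>\<^sup>+z. ennreal (cmod (d n z)) \<partial>circle) \<le> ennreal ((1/2) ^ n)" for n
  proof -
    define a :: real where "a = (1/2) ^ n"
    define b where "b = 1 / (2 * a)"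
    have "a > 0" by (simp add: a_def)
    then have "b \<ge> 0" by (simp add: b_def)
    have sum_eq: "ennreal (a/2) + ennreal b * ennreal (t\<^sup>2) = ennreal (a/2 + b * t\<^sup>2)" for t
      using \<open>a > 0\<close> \<open>b \<ge> 0\<close> by (simp add: ennreal_mult)
    have "t \<le> a/2 + b * t\<^sup>2" for t :: real
      using zero_le_power2[of "t - a"] \<open>a > 0\<close>
      by (simp add: b_def field_simps power2_eq_square)
    then have "ennreal t \<le> ennreal (a/2) + ennreal b * ennreal (t\<^sup>2)" for t :: real
      unfolding sum_eq by (rule ennreal_leI)
    then have "(\<integral>\<^sup>+z. ennreal (cmod (d n z)) \<partial>circle)
        \<le> (\<integral>\<^sup>+z. ennreal (a/2) + ennreal b * ennreal ((cmod (d n z))\<^sup>2) \<partial>circle)"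
      by (intro nn_integral_mono)
    also have "\<dots> = ennreal (a/2) + ennreal b * ennreal ((dist (X (r (Suc n))) (X (r n)))\<^sup>2)"
      unfolding d_def
      by (subst nn_integral_add, measurable)
         (simp add: nn_integral_cmult nn prob_space.emeasure_space_1[OF prob_space_circle])
    also have "\<dots> \<le> ennreal (a/2) + ennreal b * ennreal (a\<^sup>2)"
      using close[of n "Suc n"] by (intro add_left_mono mult_left_mono ennreal_leI power_mono) (auto simp: a_def)
    also have "\<dots> = ennreal a"
      unfolding sum_eq using \<open>a > 0\<close> by (simp add: b_def power2_eq_square)
    finally show ?thesis by (simp add: a_def)
  qed
  have "(\<integral>\<^sup>+z. (\<Sum>n. ennreal (cmod (d n z))) \<partial>circle) = (\<Sum>n. \<integral>\<^sup>+z. ennreal (cmod (d n z)) \<partial>circle)"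
    by (rule nn_integral_suminf) measurable
  also have "\<dots> \<le> (\<Sum>n. ennreal ((1/2) ^ n))"
    by (intro suminf_le d_le) auto
  also have "\<dots> = ennreal (\<Sum>n. (1/2) ^ n)"
    by (rule suminf_ennreal2) (auto intro: summable_geometric)
  finally have "(\<integral>\<^sup>+z. (\<Sum>n. ennreal (cmod (d n z))) \<partial>circle) \<noteq> \<infinity>"
    by (metis ennreal_less_top infinity_ennreal_def leD)
  then have "AE z in circle. (\<Sum>n. ennreal (cmod (d n z))) \<noteq> \<infinity>"
    by (intro nn_integral_noteq_infinite) measurable
  then have conv: "AE z in circle. (\<lambda>n. F (r n) z) \<longlonglongrightarrow> lim (\<lambda>n. F (r n) z)"
  proof eventually_elim
    case (elim z)
    then have "summable (\<lambda>n. cmod (d n z))"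
      by (intro summable_suminf_not_top) auto
    then have "summable (\<lambda>n. d n z)"
      by (rule summable_norm_cancel)
    then have "(\<lambda>n. \<Sum>i<n. d i z) \<longlonglongrightarrow> (\<Sum>n. d n z)"
      by (rule summable_LIMSEQ)
    moreover have "(\<Sum>i<n. d i z) = F (r n) z - F (r 0) z" for n
      unfolding d_def by (rule sum_lessThan_telescope)
    ultimately have "(\<lambda>n. (F (r n) z - F (r 0) z) + F (r 0) z) \<longlonglongrightarrow> (\<Sum>n. d n z) + F (r 0) z"
      by (intro tendsto_add) auto
    then have "convergent (\<lambda>n. F (r n) z)"
      by (auto simp: convergent_def)
    then show ?case by (simp add: convergent_LIMSEQ_iff)
  qed
  define G where "G z = lim (\<lambda>n. F (r n) z)" for z
  have [measurable]: "G \<in> borel_measurable circle"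
    unfolding G_def by (rule borel_measurable_lim_metric) measurable
  have diff_le: "(\<integral>\<^sup>+z. ennreal ((cmod (F (r n) z - G z))\<^sup>2) \<partial>circle) \<le> ennreal (((1/2) ^ n)\<^sup>2)" for n
  proof -
    have "(\<integral>\<^sup>+z. ennreal ((cmod (F (r n) z - G z))\<^sup>2) \<partial>circle)
        = (\<integral>\<^sup>+z. liminf (\<lambda>m. ennreal ((cmod (F (r m) z - F (r n) z))\<^sup>2)) \<partial>circle)"
    proof (rule nn_integral_cong_AE)
      show "AE z in circle. ennreal ((cmod (F (r n) z - G z))\<^sup>2) =
          liminf (\<lambda>m. ennreal ((cmod (F (r m) z - F (r n) z))\<^sup>2))"
        using conv
      proof eventually_elim
        case (elim z)
        have "(\<lambda>m. ennreal ((cmod (F (r m) z - F (r n) z))\<^sup>2)) \<longlonglongrightarrow> ennreal ((cmod (G z - F (r n) z))\<^sup>2)"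
          unfolding G_def by (intro tendsto_intros elim)
        then have "liminf (\<lambda>m. ennreal ((cmod (F (r m) z - F (r n) z))\<^sup>2)) = ennreal ((cmod (G z - F (r n) z))\<^sup>2)"
          by (rule lim_imp_Liminf[OF trivial_limit_sequentially])
        then show ?case
          by (simp only: norm_minus_commute)
      qed
    qed
    also have "\<dots> \<le> liminf (\<lambda>m. \<integral>\<^sup>+z. ennreal ((cmod (F (r m) z - F (r n) z))\<^sup>2) \<partial>circle)"
      by (rule nn_integral_liminf) measurable
    also have "\<dots> \<le> liminf (\<lambda>m. ennreal (((1/2) ^ n)\<^sup>2))"
    proof (rule Liminf_mono)
      show "\<forall>\<^sub>F m in sequentially. (\<integral>\<^sup>+z. ennreal ((cmod (F (r m) z - F (r n) z))\<^sup>2) \<partial>circle)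
          \<le> ennreal (((1/2) ^ n)\<^sup>2)"
        using eventually_ge_at_top[of n]
      proof eventually_elim
        case (elim m)
        then show ?case
          unfolding nn using close[of n m] by (intro ennreal_leI power_mono) auto
      qed
    qed
    also have "\<dots> = ennreal (((1/2) ^ n)\<^sup>2)"
      by (simp add: Liminf_const)
    finally show ?thesis .
  qed
  have sq_diff: "sq_int (\<lambda>z. F (r n) z - G z)" for n
  proof -
    have "(\<integral>\<^sup>+z. ennreal ((cmod (F (r n) z - G z))\<^sup>2) \<partial>circle) < \<infinity>"
      using diff_le[of n] by (auto intro: le_less_trans)
    then show ?thesis
      by (auto simp: sq_int_def integrable_iff_bounded)
  qed
  have sq_G: "sq_int G"
    using sq_int_diff[OF F(1) sq_diff, of "r 0" 0] by simp
  have dist_le: "dist (X (r n)) (abs_L2 G) \<le> (1/2) ^ n" for n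
  proof -
    have "ennreal ((dist (X (r n)) (abs_L2 G))\<^sup>2) = (\<integral>\<^sup>+z. ennreal ((cmod (F (r n) z - G z))\<^sup>2) \<partial>circle)"
      using sq_diff[of n]
      by (subst nn_integral_eq_integral)
         (auto simp: sq_int_def dist_norm F(2) abs_L2_diff[OF F(1) sq_G] norm_abs_L2[OF sq_diff])
    also note diff_le[of n]
    finally have "(dist (X (r n)) (abs_L2 G))\<^sup>2 \<le> ((1/2) ^ n)\<^sup>2"
      by simp
    then show ?thesis
      by (rule power2_le_imp_le) simp
  qed
  have "(\<lambda>n. dist (X (r n)) (abs_L2 G)) \<longlonglongrightarrow> 0"
    by (rule tendsto_sandwich[where f = "\<lambda>_. 0" and h = "\<lambda>n. (1/2) ^ n"])
       (auto simp: dist_le intro!: LIMSEQ_power_zero)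
  then have "(X \<circ> r) \<longlonglongrightarrow> abs_L2 G"
    by (subst tendsto_dist_iff) (simp add: o_def)
  then show "convergent X"
    using Cauchy_converges_subseq[OF \<open>Cauchy X\<close> r_mono] by (auto simp: convergent_def)
qed

text \<open>The guard only makes the operator total; it is the zero operator for symbols outside \<open>L\<^sup>\<infinity>\<close>.\<close>

lift_definition mult_op :: "(complex \<Rightarrow> complex) \<Rightarrow> L2 \<Rightarrow> L2" is
  "\<lambda>\<phi> f z. if \<phi> \<in> Linf then \<phi> z * f z else 0"
proof -
  fix \<phi> f g assume *: "L2_rel f g"
  show "L2_rel (\<lambda>z. if \<phi> \<in> Linf then \<phi> z * f z else 0) (\<lambda>z. if \<phi> \<in> Linf then \<phi> z * g z else 0)"
  proof (cases "\<phi> \<in> Linf")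
    case True
    then have "sq_int (\<lambda>z. \<phi> z * h z)" if "sq_int h" for h
      using that by (intro sq_int_mult_bounded[OF _ _ Linf_AE_le]) (auto simp: Linf_def)
    then show ?thesis
      using * True by (auto simp: L2_rel_def)
  qed (simp add: L2_rel_def sq_int_zero)
qed

lemma mult_op_abs_L2:
  assumes "\<phi> \<in> Linf" "sq_int f"
  shows "mult_op \<phi> (abs_L2 f) = abs_L2 (\<lambda>z. \<phi> z * f z)"
  using assms by (simp add: mult_op.abs_eq L2_rel_refl_iff)

end

theory Submission
  imports Defs
begin

interpretation circle: prob_space circle
  by (rule prob_space_circle)

text \<open>If \<open>|\<phi>|\<close> takes values in a well-ordered set, let \<open>l\<close> be the least value on which some element of a
  reducing subspace \<open>M\<close> lives. Powers of a normalised \<open>c - |\<phi>|\<^sup>2\<close> applied to such an element converge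
  to its part on \<open>{|\<phi>| = l}\<close>, which thus lies in \<open>M\<close> and attains the minimum modulus \<open>l\<close>. Conversely,
  minimum attainment on the subspace of functions living on \<open>E\<close> says that \<open>|\<phi>|\<close> attains its essential
  infimum over \<open>E\<close> on a set of positive measure. Applied to unions of level sets of positive measure
  this yields the well-ordering, and applied to the rest of the circle it shows that these level
  sets exhaust it.\<close>

section \<open>Multiplication operators\<close>

lemma LinfI:
  assumes "f \<in> borel_measurable circle" "AE z in circle. cmod (f z) \<le> C"
  shows "f \<in> Linf"
proof -
  have "esssup circle (\<lambda>z. ereal (cmod (f z))) \<le> ereal C"
    using assms by (intro esssup_I) auto
  then have "esssup circle (\<lambda>z. ereal (cmod (f z))) < \<infinity>"
    by (rule order.strict_trans1) simp
  then show ?thesis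
    using assms(1) by (simp add: Linf_def)
qed

lemma Linf_measurable: "f \<in> Linf \<Longrightarrow> f \<in> borel_measurable circle"
  by (simp add: Linf_def)

lemma Linf_mult:
  assumes "f \<in> Linf" "g \<in> Linf"
  shows "(\<lambda>z. f z * g z) \<in> Linf"
proof (rule LinfI)
  show "(\<lambda>z. f z * g z) \<in> borel_measurable circle"
    using assms by (intro borel_measurable_times Linf_measurable)
  show "AE z in circle. cmod (f z * g z) \<le> Linf_norm f * Linf_norm g"
    using Linf_AE_le[OF assms(1)] Linf_AE_le[OF assms(2)]
    by eventually_elim (auto simp: norm_mult intro: mult_mono order_trans[OF norm_ge_zero])
qed

lemma Linf_const: "(\<lambda>_. c) \<in> Linf"
  by (rule LinfI[where C = "cmod c"]) auto

lemma Linf_power: "f \<in> Linf \<Longrightarrow> (\<lambda>z. f z ^ n) \<in> Linf"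
  by (induction n) (auto intro: Linf_const Linf_mult)

lemma Linf_cnj: "f \<in> Linf \<Longrightarrow> (\<lambda>z. cnj (f z)) \<in> Linf"
  by (rule LinfI[where C = "Linf_norm f"])
     (auto dest: Linf_AE_le intro: measurable_compose[OF Linf_measurable cnj_measurable])

lemma Linf_indicator: "E \<in> sets circle \<Longrightarrow> indicator E \<in> Linf"
  by (rule LinfI[where C = 1]) (auto simp: indicator_def)

text \<open>A negative essential bound on a modulus would fail at every point, and the circle is not
  a null set.\<close>

lemma Linf_norm_nonneg:
  assumes "f \<in> Linf"
  shows "0 \<le> Linf_norm f"
proof (rule ccontr)
  assume neg: "\<not> 0 \<le> Linf_norm f"
  have "AE z in circle. False"
    using Linf_AE_le[OF assms] by eventually_elim (use neg norm_ge_zero order_trans in blast)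
  then show False by simp
qed

section \<open>Representatives of classes in \<open>L2\<close>\<close>

lemma rep_L2_measurable [measurable]: "rep_L2 x \<in> borel_measurable circle"
  using sq_int_rep_L2[of x] by (simp add: sq_int_def)

lemma integrable_rep_L2: "integrable circle (\<lambda>z. (cmod (rep_L2 x z))\<^sup>2)"
  using sq_int_rep_L2[of x] by (simp add: sq_int_def)

lemma rep_abs_L2:
  assumes "sq_int f"
  shows "AE z in circle. rep_L2 (abs_L2 f) z = f z"
  using Quotient_rep_abs[OF Quotient_L2, of f] assms
  by (simp add: L2_rel_refl_iff) (simp add: L2_rel_def)

text \<open>Operator identities below are proved by passing to representatives and comparing them
  almost everywhere.\<close>

lemma L2_eqI:
  assumes "AE z in circle. rep_L2 x z = rep_L2 y z"
  shows "x = y"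
proof -
  have "L2_rel (rep_L2 x) (rep_L2 y)"
    using assms by (simp add: L2_rel_def sq_int_rep_L2)
  then have "abs_L2 (rep_L2 x) = abs_L2 (rep_L2 y)"
    using Quotient_rel_abs[OF Quotient_L2] by blast
  then show ?thesis
    by (simp add: abs_rep_L2)
qed

lemma rep_L2_zero: "AE z in circle. rep_L2 0 z = 0"
  using rep_abs_L2[OF sq_int_zero] by (simp add: zero_L2_def)

lemma rep_L2_add: "AE z in circle. rep_L2 (x + y) z = rep_L2 x z + rep_L2 y z"
  using rep_abs_L2[OF sq_int_add[OF sq_int_rep_L2[of x] sq_int_rep_L2[of y]]]
  by (simp add: plus_L2_def)

lemma rep_L2_diff: "AE z in circle. rep_L2 (x - y) z = rep_L2 x z - rep_L2 y z"
  using rep_abs_L2[OF sq_int_diff[OF sq_int_rep_L2[of x] sq_int_rep_L2[of y]]]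
  by (simp add: minus_L2_def)

lemma rep_L2_scaleC: "AE z in circle. rep_L2 (c *\<^sub>C x) z = c * rep_L2 x z"
  using rep_abs_L2[OF sq_int_scale[OF sq_int_rep_L2[of x]]]
  by (simp add: scaleC_L2_def)

lemma rep_mult_op:
  assumes "\<phi> \<in> Linf"
  shows "AE z in circle. rep_L2 (mult_op \<phi> x) z = \<phi> z * rep_L2 x z"
proof -
  have "sq_int (\<lambda>z. \<phi> z * rep_L2 x z)"
    using assms by (intro sq_int_mult_bounded[OF sq_int_rep_L2 _ Linf_AE_le] Linf_measurable)
  from rep_abs_L2[OF this] show ?thesis
    using mult_op_abs_L2[OF assms sq_int_rep_L2[of x]] by (simp add: abs_rep_L2)
qed

lemma norm_L2_sq: "(norm x)\<^sup>2 = (\<integral>z. (cmod (rep_L2 x z))\<^sup>2 \<partial>circle)"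
  using norm_abs_L2[OF sq_int_rep_L2[of x]] by (simp add: abs_rep_L2)

text \<open>A constant on each side lets the same comparison give upper bounds
  \<open>norm (A x) \<le> D * norm x\<close> and lower bounds
  \<open>C * norm y \<le> norm (A y)\<close> for multiplication operators.\<close>

lemma norm_L2_mono:
  assumes "AE z in circle. C * cmod (rep_L2 x z) \<le> D * cmod (rep_L2 y z)" "0 \<le> C" "0 \<le> D"
  shows "C * norm x \<le> D * norm y"
proof (rule power2_le_imp_le)
  have "(\<integral>z. (C * cmod (rep_L2 x z))\<^sup>2 \<partial>circle) \<le> (\<integral>z. (D * cmod (rep_L2 y z))\<^sup>2 \<partial>circle)"
  proof (rule integral_mono_AE)
    show "AE z in circle. (C * cmod (rep_L2 x z))\<^sup>2 \<le> (D * cmod (rep_L2 y z))\<^sup>2"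
      using assms(1) by eventually_elim (use assms(2) in \<open>auto intro: power_mono\<close>)
  qed (simp_all add: power_mult_distrib integrable_rep_L2)
  then show "(C * norm x)\<^sup>2 \<le> (D * norm y)\<^sup>2"
    by (simp add: power_mult_distrib norm_L2_sq)
qed (use assms in auto)

lemma L2_eq_zero_iff: "x = 0 \<longleftrightarrow> (AE z in circle. rep_L2 x z = 0)"
proof
  assume "AE z in circle. rep_L2 x z = 0"
  with rep_L2_zero have "AE z in circle. rep_L2 x z = rep_L2 0 z"
    by eventually_elim simp
  then show "x = 0" by (rule L2_eqI)
qed (use rep_L2_zero in blast)

section \<open>Algebra, boundedness, adjoint and continuity of multiplication operators\<close>

lemma mult_op_add:
  assumes "\<phi> \<in> Linf"
  shows "mult_op \<phi> (x + y) = mult_op \<phi> x + mult_op \<phi> y"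
  by (rule L2_eqI)
     (use rep_mult_op[OF assms, of "x + y"] rep_mult_op[OF assms, of x] rep_mult_op[OF assms, of y]
        rep_L2_add[of x y] rep_L2_add[of "mult_op \<phi> x" "mult_op \<phi> y"]
      in \<open>eventually_elim, simp add: algebra_simps\<close>)

lemma mult_op_zero: "\<phi> \<in> Linf \<Longrightarrow> mult_op \<phi> 0 = 0"
  using mult_op_add[of \<phi> 0 0] by simp

lemma mult_op_scaleC:
  assumes "\<phi> \<in> Linf"
  shows "mult_op \<phi> (c *\<^sub>C x) = c *\<^sub>C mult_op \<phi> x"
  by (rule L2_eqI)
     (use rep_mult_op[OF assms, of "c *\<^sub>C x"] rep_mult_op[OF assms, of x]
        rep_L2_scaleC[of c x] rep_L2_scaleC[of c "mult_op \<phi> x"]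
      in \<open>eventually_elim, simp add: algebra_simps\<close>)

lemma mult_op_mult:
  assumes "\<phi> \<in> Linf" "\<psi> \<in> Linf"
  shows "mult_op \<phi> (mult_op \<psi> x) = mult_op (\<lambda>z. \<phi> z * \<psi> z) x"
  by (rule L2_eqI)
     (use rep_mult_op[OF assms(1), of "mult_op \<psi> x"] rep_mult_op[OF assms(2), of x]
        rep_mult_op[OF Linf_mult[OF assms], of x]
      in \<open>eventually_elim, simp\<close>)

lemma mult_op_commute:
  assumes "\<phi> \<in> Linf" "\<psi> \<in> Linf"
  shows "mult_op \<phi> (mult_op \<psi> x) = mult_op \<psi> (mult_op \<phi> x)"
  using assms by (simp add: mult_op_mult mult.commute)

lemma norm_mult_op_le:
  assumes "\<phi> \<in> Linf"
  shows "norm (mult_op \<phi> x) \<le> Linf_norm \<phi> * norm x"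
proof -
  have "AE z in circle. 1 * cmod (rep_L2 (mult_op \<phi> x) z) \<le> Linf_norm \<phi> * cmod (rep_L2 x z)"
    using rep_mult_op[OF assms, of x] Linf_AE_le[OF assms]
    by eventually_elim (auto simp: norm_mult intro: mult_right_mono)
  from norm_L2_mono[OF this] show ?thesis
    using Linf_norm_nonneg[OF assms] by simp
qed

lemma bounded_clinear_mult_op: "\<phi> \<in> Linf \<Longrightarrow> bounded_clinear (mult_op \<phi>)"
  unfolding bounded_clinear_def using mult_op_add mult_op_scaleC norm_mult_op_le by blast

lemma cadjoint_mult_op:
  assumes "\<phi> \<in> Linf"
  shows "cadjoint (mult_op \<phi>) = mult_op (\<lambda>z. cnj (\<phi> z))"
proof (rule cadjoint_eqI)
  fix x y
  have cinner_rep: "cinner u v = (\<integral>z. rep_L2 u z * cnj (rep_L2 v z) \<partial>circle)" for u v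
    by (simp add: cinner_L2_def)
  show "cinner (mult_op \<phi> x) y = cinner x (mult_op (\<lambda>z. cnj (\<phi> z)) y)"
    unfolding cinner_rep
  proof (rule integral_cong_AE)
    show "AE z in circle. rep_L2 (mult_op \<phi> x) z * cnj (rep_L2 y z) =
        rep_L2 x z * cnj (rep_L2 (mult_op (\<lambda>z. cnj (\<phi> z)) y) z)"
      using rep_mult_op[OF assms, of x] rep_mult_op[OF Linf_cnj[OF assms], of y]
      by eventually_elim simp
  qed measurable
qed

text \<open>Serves to show that the fixed space of a multiplication operator is closed.\<close>

lemma continuous_mult_op:
  assumes "\<phi> \<in> Linf"
  shows "continuous_on UNIV (mult_op \<phi>)"
proof (rule linear_continuous_on)
  show "bounded_linear (mult_op \<phi>)"
    by (rule bounded_linear_intro[where K = "Linf_norm \<phi>"])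
       (simp_all add: assms mult_op_add mult_op_scaleC scaleR_scaleC norm_mult_op_le mult.commute)
qed

section \<open>Reducing subspaces and level sets\<close>

text \<open>This replaces the spectral theorem: powers of a function peaking at 1 converge to the
  indicator of its peak set.\<close>

lemma peak_set_invariant:
  assumes M: "closed M" "mult_op g ` M \<subseteq> M" and g: "g \<in> Linf" and x: "x \<in> M"
    and peak: "AE z in circle. rep_L2 x z = 0 \<or> g z = 1 \<or> cmod (g z) < 1"
  shows "mult_op (indicator {z \<in> space circle. g z = 1}) x \<in> M"
proof -
  define P where "P = {z \<in> space circle. g z = 1}"
  have [measurable]: "g \<in> borel_measurable circle"
    by (rule Linf_measurable[OF g])
  have P [measurable]: "P \<in> sets circle"
    unfolding P_def by measurable
  have in_M: "mult_op (\<lambda>z. g z ^ n) x \<in> M" for n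
  proof (induction n)
    case 0
    have "mult_op (\<lambda>z. g z ^ 0) x = x"
      by (rule L2_eqI) (use rep_mult_op[OF Linf_const, of 1 x] in simp)
    then show ?case using x by simp
  next
    case (Suc n)
    then show ?case
      using M(2) mult_op_mult[OF g Linf_power[OF g], of n x] by (auto simp: image_subset_iff)
  qed
  define D where "D n = mult_op (\<lambda>z. g z ^ n) x - mult_op (indicator P) x" for n
  define d where "d n z = (cmod ((g z ^ n - indicator P z) * rep_L2 x z))\<^sup>2" for n z
  have norm_D: "(norm (D n))\<^sup>2 = (\<integral>z. d n z \<partial>circle)" for n
    unfolding norm_L2_sq
  proof (rule integral_cong_AE)
    show "AE z in circle. (cmod (rep_L2 (D n) z))\<^sup>2 = d n z"
      using rep_mult_op[OF Linf_power[OF g], of n x] rep_mult_op[OF Linf_indicator[OF P], of x]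
        rep_L2_diff[of "mult_op (\<lambda>z. g z ^ n) x" "mult_op (indicator P) x"]
      by eventually_elim (simp add: D_def d_def left_diff_distrib)
  qed (unfold d_def, measurable)
  have "(\<lambda>n. \<integral>z. d n z \<partial>circle) \<longlonglongrightarrow> (\<integral>z. 0 \<partial>circle)"
  \<comment> \<open>Where \<open>x\<close> does not vanish, \<open>g z ^ n\<close> and the indicator
    both have modulus at most 1. Their difference is then at most 2, whence the factor 4 after
    squaring.\<close>
  proof (rule integral_dominated_convergence[where w = "\<lambda>z. 4 * (cmod (rep_L2 x z))\<^sup>2"])
    show "AE z in circle. (\<lambda>n. d n z) \<longlonglongrightarrow> 0"
      using peak AE_space
    proof eventually_elim
      case (elim z)
      then consider "rep_L2 x z = 0" | "g z = 1" "z \<in> P" | "cmod (g z) < 1" "z \<notin> P"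
        by (auto simp: P_def)
      then show ?case
      proof cases
        case 3
        then have "(\<lambda>n. (cmod (g z ^ n * rep_L2 x z))\<^sup>2) \<longlonglongrightarrow> (cmod (0 * rep_L2 x z))\<^sup>2"
          by (intro tendsto_intros LIMSEQ_power_zero)
        with 3 show ?thesis by (simp add: d_def)
      qed (simp_all add: d_def)
    qed
    show "AE z in circle. norm (d n z) \<le> 4 * (cmod (rep_L2 x z))\<^sup>2" for n
      using peak
    proof eventually_elim
      case (elim z)
      have "cmod (g z ^ n - indicator P z) \<le> 2" if "rep_L2 x z \<noteq> 0"
      proof -
        have "cmod (g z) \<le> 1" using elim that by auto
        then have "cmod (g z ^ n) \<le> 1" by (simp add: norm_power power_le_one)
        moreover have "cmod (indicator P z) \<le> 1" by (simp add: indicator_def)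
        ultimately show ?thesis
          using norm_triangle_ineq4[of "g z ^ n" "indicator P z"] by linarith
      qed
      then have "cmod ((g z ^ n - indicator P z) * rep_L2 x z) \<le> 2 * cmod (rep_L2 x z)"
        by (cases "rep_L2 x z = 0") (auto simp: norm_mult)
      then have "d n z \<le> (2 * cmod (rep_L2 x z))\<^sup>2"
        unfolding d_def by (rule power_mono) simp
      then show ?case
        by (simp add: d_def power_mult_distrib)
    qed
  qed (auto simp: d_def integrable_rep_L2)
  then have "(\<lambda>n. sqrt ((norm (D n))\<^sup>2)) \<longlonglongrightarrow> sqrt 0"
    unfolding norm_D by (intro tendsto_real_sqrt) simp
  then have "D \<longlonglongrightarrow> 0"
    by (simp add: tendsto_norm_zero_iff)
  then have "(\<lambda>n. mult_op (\<lambda>z. g z ^ n) x) \<longlonglongrightarrow> mult_op (indicator P) x"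
    unfolding D_def by (rule LIM_zero_cancel)
  then show ?thesis
    unfolding P_def by (rule closed_sequentially[OF M(1) in_M])
qed

lemma csubspace_diff: "csubspace M \<Longrightarrow> x \<in> M \<Longrightarrow> y \<in> M \<Longrightarrow> x - y \<in> M"
proof -
  assume M: "csubspace M" "x \<in> M" "y \<in> M"
  then have "x + (- 1) *\<^sub>C y \<in> M" by (auto simp: csubspace_def)
  moreover have "(- 1) *\<^sub>C y = - y" using scaleR_scaleC[of "- 1" y] by simp
  ultimately show ?thesis by simp
qed

text \<open>The peaking function is \<open>(c - |\<phi>|\<^sup>2) / (c - l\<^sup>2)\<close> with \<open>c > \<parallel>\<phi>\<parallel>\<^sub>\<infinity>\<^sup>2\<close>, a polynomial in
  \<open>M\<^sub>\<phi>\<^sup>* M\<^sub>\<phi>\<close>.\<close>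

lemma reduces_lowest_level:
  assumes \<phi>: "\<phi> \<in> Linf" and M: "csubspace M" "closed M" "reduces M (mult_op \<phi>)"
    and x: "x \<in> M" and l: "0 \<le> l" "l \<le> Linf_norm \<phi>"
    and low: "AE z in circle. rep_L2 x z = 0 \<or> l \<le> cmod (\<phi> z)"
  shows "mult_op (indicator {z \<in> space circle. cmod (\<phi> z) = l}) x \<in> M"
proof -
  define N where "N = Linf_norm \<phi>"
  \<comment> \<open>The summand 1 keeps the denominator \<open>c - l\<^sup>2\<close> positive even
    for \<open>l = N\<close>, and makes \<open>g\<close> positive almost everywhere, so that
    \<open>g < 1\<close> already bounds its modulus. Where \<open>cmod (\<phi> z) < l\<close> the
    function \<open>g\<close> exceeds 1, but there \<open>x\<close> vanishes by
    \<open>low\<close>.\<close>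
  define c where "c = N\<^sup>2 + 1"
  have "l\<^sup>2 \<le> N\<^sup>2" using l by (simp add: N_def power_mono)
  then have c: "l\<^sup>2 < c" by (simp add: c_def)
  define g where "g z = complex_of_real ((c - (cmod (\<phi> z))\<^sup>2) / (c - l\<^sup>2))" for z
  have [measurable]: "\<phi> \<in> borel_measurable circle"
    by (rule Linf_measurable[OF \<phi>])
  have AE_c: "AE z in circle. (cmod (\<phi> z))\<^sup>2 < c"
    using Linf_AE_le[OF \<phi>]
  proof eventually_elim
    case (elim z)
    then have "(cmod (\<phi> z))\<^sup>2 \<le> N\<^sup>2" unfolding N_def by (rule power_mono) simp
    then show ?case by (simp add: c_def)
  qed
  have g: "g \<in> Linf"
  proof (rule LinfI[where C = "c / (c - l\<^sup>2)"])
    show "g \<in> borel_measurable circle" unfolding g_def by measurable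
    show "AE z in circle. cmod (g z) \<le> c / (c - l\<^sup>2)"
      using AE_c by eventually_elim (use c in \<open>auto simp: g_def norm_divide divide_right_mono simp del: of_real_divide of_real_diff\<close>)
  qed
  let ?h = "\<lambda>z. cnj (\<phi> z) * \<phi> z"
  have h: "?h \<in> Linf" by (intro Linf_mult Linf_cnj \<phi>)
  have inv: "mult_op g ` M \<subseteq> M"
  proof (rule image_subsetI)
    fix y assume y: "y \<in> M"
    have "mult_op \<phi> y \<in> M"
      using M(3) y by (auto simp: reduces_def)
    then have "mult_op (\<lambda>z. cnj (\<phi> z)) (mult_op \<phi> y) \<in> M"
      using M(3) by (auto simp: reduces_def cadjoint_mult_op[OF \<phi>])
    then have hy: "mult_op ?h y \<in> M"
      by (simp add: mult_op_mult[OF Linf_cnj[OF \<phi>] \<phi>])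
    define a b where "a = complex_of_real (c / (c - l\<^sup>2))" and "b = complex_of_real (1 / (c - l\<^sup>2))"
    have "?h z = complex_of_real ((cmod (\<phi> z))\<^sup>2)" for z
      unfolding complex_norm_square by (rule mult.commute)
    then have g_eq: "g z = a - b * ?h z" for z
      by (simp add: g_def a_def b_def diff_divide_distrib)
    have "mult_op g y = a *\<^sub>C y - b *\<^sub>C mult_op ?h y"
    proof (rule L2_eqI)
      show "AE z in circle. rep_L2 (mult_op g y) z = rep_L2 (a *\<^sub>C y - b *\<^sub>C mult_op ?h y) z"
        using rep_mult_op[OF g, of y] rep_mult_op[OF h, of y] rep_L2_scaleC[of a y]
          rep_L2_scaleC[of b "mult_op ?h y"] rep_L2_diff[of "a *\<^sub>C y" "b *\<^sub>C mult_op ?h y"]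
        by eventually_elim (simp add: g_eq left_diff_distrib mult.assoc)
    qed
    moreover have "a *\<^sub>C y \<in> M" "b *\<^sub>C mult_op ?h y \<in> M"
      using M(1) y hy by (auto simp: csubspace_def)
    ultimately show "mult_op g y \<in> M"
      using csubspace_diff[OF M(1)] by simp
  qed
  have g1: "g z = 1 \<longleftrightarrow> cmod (\<phi> z) = l" for z
  proof -
    have "g z = 1 \<longleftrightarrow> (cmod (\<phi> z))\<^sup>2 = l\<^sup>2"
      using c by (auto simp add: g_def simp del: of_real_divide of_real_diff)
    then show ?thesis using l(1) by simp
  qed
  have "AE z in circle. rep_L2 x z = 0 \<or> g z = 1 \<or> cmod (g z) < 1"
    using low AE_c
  proof eventually_elim
    case (elim z)
    have "cmod (g z) < 1" if "l < cmod (\<phi> z)"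
    proof -
      have "l\<^sup>2 < (cmod (\<phi> z))\<^sup>2" using that l(1) by (intro power_strict_mono) auto
      then show ?thesis
        using elim(2) c by (simp add: g_def norm_divide del: of_real_divide of_real_diff)
    qed
    then show ?case using elim(1) g1 by force
  qed
  from peak_set_invariant[OF M(2) inv g x this] show ?thesis
    by (simp add: g1)
qed

section \<open>Minimum modulus, well-ordered sets of reals, and sufficiency of the
  decomposition\<close>

lemma min_attaining_onI:
  assumes "x \<in> M" "norm x = 1" "\<And>y. y \<in> M \<Longrightarrow> norm y = 1 \<Longrightarrow> norm (A x) \<le> norm (A y)"
  shows "min_attaining_on M A"
  unfolding min_attaining_on_def min_modulus_on_def
  by (intro bexI[of _ x] conjI cInf_eq_minimum[symmetric]) (use assms in auto)

lemma min_modulus_on_le: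
  assumes "y \<in> M" "norm y = 1"
  shows "min_modulus_on M A \<le> norm (A y)"
  unfolding min_modulus_on_def
  by (intro cInf_lower bdd_belowI[where m = 0]) (use assms in auto)

text \<open>The order of the reals restricted to \<Lambda> is always a linear order, so only
  well-foundedness of its strict part is at stake. In a linear order a minimal element of a subset
  is its least element.\<close>

lemma well_order_on_real_iff:
  fixes \<Lambda> :: "real set"
  shows "well_order_on \<Lambda> {(a, b). a \<in> \<Lambda> \<and> b \<in> \<Lambda> \<and> a \<le> b} \<longleftrightarrow>
    (\<forall>S\<subseteq>\<Lambda>. S \<noteq> {} \<longrightarrow> (\<exists>m\<in>S. \<forall>l\<in>S. m \<le> l))" (is "well_order_on \<Lambda> ?R \<longleftrightarrow> ?min")
proof
  assume "well_order_on \<Lambda> ?R"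
  then have wf: "wf (?R - Id)" by (simp add: well_order_on_def)
  show ?min
  proof (intro allI impI)
    fix S assume "S \<subseteq> \<Lambda>" "S \<noteq> {}"
    obtain m where m: "m \<in> S" "\<And>y. (y, m) \<in> ?R - Id \<Longrightarrow> y \<notin> S"
      using wfE_min'[OF wf \<open>S \<noteq> {}\<close>] by blast
    have "m \<le> l" if "l \<in> S" for l
    proof (rule ccontr)
      assume "\<not> m \<le> l"
      then have "(l, m) \<in> ?R - Id" using that m(1) \<open>S \<subseteq> \<Lambda>\<close> by auto
      with m(2) that show False by blast
    qed
    with m(1) show "\<exists>m\<in>S. \<forall>l\<in>S. m \<le> l" by blast
  qed
next
  assume min: ?min
  have "wf (?R - Id)"
  proof (rule wfI_min)
    fix x :: real and Q assume "x \<in> Q"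
    \<comment> \<open>\<open>Q\<close> ranges over all sets of reals. A point outside \<Lambda> has
      no predecessor in \<open>?R\<close>, so any element serves if \<open>Q\<close> misses
      \<Lambda>; otherwise the least element of \<open>Q \<inter> \<Lambda>\<close> does.\<close>
    show "\<exists>z\<in>Q. \<forall>y. (y, z) \<in> ?R - Id \<longrightarrow> y \<notin> Q"
    proof (cases "Q \<inter> \<Lambda> = {}")
      case True
      with \<open>x \<in> Q\<close> show ?thesis by auto
    next
      case False
      then obtain m where m: "m \<in> Q \<inter> \<Lambda>" "\<forall>l\<in>Q \<inter> \<Lambda>. m \<le> l"
        using min[rule_format, of "Q \<inter> \<Lambda>"] by blast
      have "y \<notin> Q" if y: "(y, m) \<in> ?R - Id" for y
      proof
        assume "y \<in> Q"
        with y m have "m \<le> y" by blast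
        with y show False by simp
      qed
      with m show ?thesis by blast
    qed
  qed
  moreover have "refl_on \<Lambda> ?R" "?R \<subseteq> \<Lambda> \<times> \<Lambda>" "total_on \<Lambda> ?R"
    by (auto simp: refl_on_def total_on_def)
  moreover have "trans ?R" "antisym ?R"
    by (auto intro!: transI antisymI)
  ultimately show "well_order_on \<Lambda> ?R"
    by (simp add: well_order_on_def linear_order_on_def partial_order_on_def preorder_on_def)
qed

text \<open>Carries the direction from (ii) to (i), stated through the values of
  \<open>cmod (\<phi> z)\<close>: this is what both the lowest level argument and the norms see of
  the decomposition.\<close>

lemma mult_op_in_Mr:
  assumes \<phi>: "\<phi> \<in> Linf" and count: "countable \<Lambda>" and sub: "\<Lambda> \<subseteq> {0..Linf_norm \<phi>}"
    and least: "\<And>S. S \<subseteq> \<Lambda> \<Longrightarrow> S \<noteq> {} \<Longrightarrow> \<exists>m\<in>S. \<forall>l\<in>S. m \<le> l"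
    and levels: "AE z in circle. cmod (\<phi> z) \<in> \<Lambda>"
  shows "mult_op \<phi> \<in> \<M>\<^sub>r"
  unfolding reducing_min_attaining_def
proof (intro CollectI conjI allI impI; (elim conjE)?)
  show "bounded_clinear (mult_op \<phi>)" by (rule bounded_clinear_mult_op[OF \<phi>])
next
  fix M assume M: "csubspace M" "closed M" "M \<noteq> {0}" "reduces M (mult_op \<phi>)"
  have [measurable]: "\<phi> \<in> borel_measurable circle"
    by (rule Linf_measurable[OF \<phi>])
  define vanish where "vanish l x \<longleftrightarrow> (AE z in circle. cmod (\<phi> z) = l \<longrightarrow> rep_L2 x z = 0)" for l x
  define S where "S = {l \<in> \<Lambda>. \<exists>x\<in>M. \<not> vanish l x}"
  obtain x0 where x0: "x0 \<in> M" "x0 \<noteq> 0"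
    using M(1,3) by (auto simp: csubspace_def)
  \<comment> \<open>Countability of \<Lambda> merges the exceptional null sets of all levels into
    one, so an element of \<open>M\<close> vanishing on each level would be 0.\<close>
  have "S \<noteq> {}"
  proof
    assume "S = {}"
    then have "\<forall>l\<in>\<Lambda>. vanish l x0" using x0 by (auto simp: S_def)
    then have "AE z in circle. \<forall>l\<in>\<Lambda>. cmod (\<phi> z) = l \<longrightarrow> rep_L2 x0 z = 0"
      unfolding vanish_def by (subst AE_ball_countable[OF count])
    with levels have "AE z in circle. rep_L2 x0 z = 0"
      by eventually_elim auto
    then show False using x0 by (simp add: L2_eq_zero_iff)
  qed
  moreover have "S \<subseteq> \<Lambda>" by (auto simp: S_def)
  ultimately obtain l where l: "l \<in> S" "\<forall>k\<in>S. l \<le> k"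
    using least by blast
  then have l_bounds: "0 \<le> l" "l \<le> Linf_norm \<phi>"
    using sub by (auto simp: S_def)
  \<comment> \<open>Levels below \<open>l\<close> lie outside \<open>S\<close>, so every element of
    \<open>M\<close> vanishes on each of them; again countability gives one null set.\<close>
  have low: "AE z in circle. rep_L2 y z = 0 \<or> l \<le> cmod (\<phi> z)" if "y \<in> M" for y
  proof -
    have "\<forall>k\<in>\<Lambda>. AE z in circle. cmod (\<phi> z) = k \<and> k < l \<longrightarrow> rep_L2 y z = 0"
    proof
      fix k assume "k \<in> \<Lambda>"
      show "AE z in circle. cmod (\<phi> z) = k \<and> k < l \<longrightarrow> rep_L2 y z = 0"
      proof (cases "k < l")
        case True
        with l \<open>k \<in> \<Lambda>\<close> that have "vanish k y" by (force simp: S_def)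
        then show ?thesis unfolding vanish_def by eventually_elim auto
      qed auto
    qed
    then have "AE z in circle. \<forall>k\<in>\<Lambda>. cmod (\<phi> z) = k \<and> k < l \<longrightarrow> rep_L2 y z = 0"
      by (subst AE_ball_countable[OF count])
    with levels show ?thesis by eventually_elim force
  qed
  define P where "P = {z \<in> space circle. cmod (\<phi> z) = l}"
  have P [measurable]: "P \<in> sets circle" unfolding P_def by measurable
  obtain x where x: "x \<in> M" "\<not> vanish l x"
    using l by (auto simp: S_def)
  define u where "u = mult_op (indicator P) x"
  have u: "u \<in> M"
    unfolding u_def P_def using reduces_lowest_level[OF \<phi> M(1,2,4) x(1) l_bounds low[OF x(1)]] .
  have rep_u: "AE z in circle. rep_L2 u z = indicator P z * rep_L2 x z"
    unfolding u_def by (rule rep_mult_op[OF Linf_indicator[OF P]])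
  have "u \<noteq> 0"
  proof
    assume "u = 0"
    then have "AE z in circle. rep_L2 u z = 0" by (simp add: L2_eq_zero_iff)
    with rep_u AE_space have "vanish l x"
      unfolding vanish_def by eventually_elim (auto simp: P_def)
    with x show False by blast
  qed
  define v where "v = complex_of_real (inverse (norm u)) *\<^sub>C u"
  have "v \<in> M" using u M(1) by (simp add: v_def csubspace_def)
  moreover have v1: "norm v = 1"
    using \<open>u \<noteq> 0\<close> by (simp add: v_def scaleR_scaleC[symmetric] del: of_real_inverse)
  \<comment> \<open>The bound \<open>l\<close> separates the two norms: \<open>v\<close> lives where
    \<open>cmod (\<phi> z) = l\<close>, and every \<open>y\<close> in \<open>M\<close> lives where
    \<open>l \<le> cmod (\<phi> z)\<close>.\<close>
  moreover have "norm (mult_op \<phi> v) \<le> norm (mult_op \<phi> y)" if y: "y \<in> M" "norm y = 1" for y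
  proof -
    have "AE z in circle. 1 * cmod (rep_L2 (mult_op \<phi> v) z) \<le> l * cmod (rep_L2 v z)"
      using rep_mult_op[OF \<phi>, of v] rep_u rep_L2_scaleC[of "complex_of_real (inverse (norm u))" u]
      by eventually_elim (auto simp: v_def norm_mult P_def indicator_def)
    then have "norm (mult_op \<phi> v) \<le> l"
      using norm_L2_mono[of 1 "mult_op \<phi> v" l v] l_bounds v1 by simp
    also have "AE z in circle. l * cmod (rep_L2 y z) \<le> 1 * cmod (rep_L2 (mult_op \<phi> y) z)"
      using rep_mult_op[OF \<phi>, of y] low[OF y(1)]
      by eventually_elim (auto simp: norm_mult intro: mult_right_mono)
    then have "l \<le> norm (mult_op \<phi> y)"
      using norm_L2_mono[of l y 1 "mult_op \<phi> y"] l_bounds y by simp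
    finally show ?thesis .
  qed
  ultimately show "min_attaining_on M (mult_op \<phi>)"
    by (rule min_attaining_onI)
qed

section \<open>Subspaces of functions living on a set\<close>

text \<open>As the fixed space of a projection, it inherits its subspace, closedness and invariance
  properties from linearity, continuity and commutation of multiplication operators.\<close>

definition L2_on :: "complex set \<Rightarrow> L2 set" where
  "L2_on E = {x. mult_op (indicator E) x = x}"

lemma L2_onD:
  assumes "E \<in> sets circle" "x \<in> L2_on E"
  shows "AE z in circle. z \<notin> E \<longrightarrow> rep_L2 x z = 0"
proof -
  have eq: "mult_op (indicator E) x = x" using assms(2) by (simp add: L2_on_def)
  show ?thesis
    using rep_mult_op[OF Linf_indicator[OF assms(1)], of x] by eventually_elim (auto simp: eq)
qed

lemma csubspace_L2_on: "E \<in> sets circle \<Longrightarrow> csubspace (L2_on E)"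
  by (auto simp: csubspace_def L2_on_def mult_op_zero mult_op_add mult_op_scaleC Linf_indicator)

lemma closed_L2_on: "E \<in> sets circle \<Longrightarrow> closed (L2_on E)"
  unfolding L2_on_def by (intro closed_Collect_eq continuous_mult_op Linf_indicator continuous_on_id)

lemma reduces_L2_on:
  assumes "E \<in> sets circle" "\<phi> \<in> Linf"
  shows "reduces (L2_on E) (mult_op \<phi>)"
proof -
  have "mult_op \<psi> ` L2_on E \<subseteq> L2_on E" if "\<psi> \<in> Linf" for \<psi>
    using mult_op_commute[OF Linf_indicator[OF assms(1)] that] by (auto simp: L2_on_def)
  then show ?thesis
    using assms by (simp add: reduces_def cadjoint_mult_op Linf_cnj)
qed

text \<open>The witness is the normalised indicator of \<open>F\<close>. Keeping \<open>F\<close>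
  apart from \<open>E\<close> allows a test vector in \<open>L2_on E\<close> to be concentrated
  where \<open>cmod (\<phi> z)\<close> is too small.\<close>

lemma L2_on_unit_vector:
  assumes F: "F \<in> sets circle" "F \<subseteq> E" and E: "E \<in> sets circle" and pos: "0 < measure circle F"
  obtains y where "y \<in> L2_on E" "norm y = 1"
    "AE z in circle. z \<notin> F \<longrightarrow> rep_L2 y z = 0"
    "AE z in circle. z \<in> F \<longrightarrow> rep_L2 y z \<noteq> 0"
proof -
  define a where "a = 1 / sqrt (measure circle F)"
  define f where "f z = complex_of_real a * indicator F z" for z
  have a: "a \<noteq> 0" "a\<^sup>2 * measure circle F = 1"
    using pos by (auto simp: a_def power_divide)
  have sq: "(cmod (f z))\<^sup>2 = a\<^sup>2 * indicator F z" for z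
    by (simp add: f_def indicator_def)
  have "f \<in> borel_measurable circle"
    unfolding f_def using F(1) by measurable
  then have f: "sq_int f"
    unfolding sq_int_def sq using F(1) circle.emeasure_finite
    by (auto intro!: integrable_real_indicator simp: less_top[symmetric])
  define y where "y = abs_L2 f"
  have rep_y: "AE z in circle. rep_L2 y z = f z"
    unfolding y_def by (rule rep_abs_L2[OF f])
  have "(norm y)\<^sup>2 = 1"
    unfolding y_def norm_abs_L2[OF f] sq using F a by simp
  then have "norm y = 1" using power2_eq_iff_nonneg[of "norm y" 1] by simp
  moreover have "y \<in> L2_on E"
    unfolding L2_on_def mem_Collect_eq
    by (rule L2_eqI)
       (use rep_mult_op[OF Linf_indicator[OF E], of y] rep_y
        in \<open>eventually_elim, use F(2) in \<open>auto simp: f_def indicator_def\<close>\<close>)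
  moreover have "AE z in circle. z \<notin> F \<longrightarrow> rep_L2 y z = 0"
    using rep_y by eventually_elim (simp add: f_def)
  moreover have "AE z in circle. z \<in> F \<longrightarrow> rep_L2 y z \<noteq> 0"
    using rep_y by eventually_elim (simp add: f_def a)
  ultimately show thesis using that by blast
qed

text \<open>Turns a comparison with the minimum modulus into the sign of one integral. Once its
  integrand has constant sign, a vanishing integral forces the integrand to vanish almost
  everywhere.\<close>

lemma norm_mult_op_diff:
  assumes \<phi>: "\<phi> \<in> Linf"
  shows "integrable circle (\<lambda>z. ((cmod (\<phi> z))\<^sup>2 - m\<^sup>2) * (cmod (rep_L2 x z))\<^sup>2)" (is ?int)
    and "(\<integral>z. ((cmod (\<phi> z))\<^sup>2 - m\<^sup>2) * (cmod (rep_L2 x z))\<^sup>2 \<partial>circle) =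
      (norm (mult_op \<phi> x))\<^sup>2 - m\<^sup>2 * (norm x)\<^sup>2" (is ?eq)
proof -
  have [measurable]: "\<phi> \<in> borel_measurable circle"
    by (rule Linf_measurable[OF \<phi>])
  have eq: "AE z in circle. (cmod (rep_L2 (mult_op \<phi> x) z))\<^sup>2 - m\<^sup>2 * (cmod (rep_L2 x z))\<^sup>2 =
      ((cmod (\<phi> z))\<^sup>2 - m\<^sup>2) * (cmod (rep_L2 x z))\<^sup>2"
    using rep_mult_op[OF \<phi>, of x]
    by eventually_elim (simp add: norm_mult power_mult_distrib algebra_simps)
  have int: "integrable circle
      (\<lambda>z. (cmod (rep_L2 (mult_op \<phi> x) z))\<^sup>2 - m\<^sup>2 * (cmod (rep_L2 x z))\<^sup>2)"
    by (simp add: integrable_rep_L2)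
  show ?int
    by (rule integrable_cong_AE_imp[OF int]) (use eq in auto)
  have "(\<integral>z. ((cmod (\<phi> z))\<^sup>2 - m\<^sup>2) * (cmod (rep_L2 x z))\<^sup>2 \<partial>circle) =
      (\<integral>z. (cmod (rep_L2 (mult_op \<phi> x) z))\<^sup>2 - m\<^sup>2 * (cmod (rep_L2 x z))\<^sup>2 \<partial>circle)"
    by (rule integral_cong_AE) (use eq in auto)
  then show ?eq
    by (simp add: integrable_rep_L2 norm_L2_sq)
qed

text \<open>Here \<open>m\<close> is the minimum modulus. Unit vectors concentrated where
  \<open>cmod (\<phi> z) < m\<close> would have images of norm below \<open>m\<close>, and a
  minimiser can only live where equality holds.\<close>

lemma min_attaining_on_L2_on:
  assumes \<phi>: "\<phi> \<in> Linf" and E: "E \<in> sets circle"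
    and att: "min_attaining_on (L2_on E) (mult_op \<phi>)"
  obtains m where "AE z in circle. z \<in> E \<longrightarrow> m \<le> cmod (\<phi> z)"
    "\<not> (AE z in circle. z \<in> E \<longrightarrow> cmod (\<phi> z) \<noteq> m)"
proof -
  have [measurable]: "\<phi> \<in> borel_measurable circle" "E \<in> sets circle"
    by (auto intro: Linf_measurable[OF \<phi>] E)
  define m where "m = min_modulus_on (L2_on E) (mult_op \<phi>)"
  obtain x where x: "x \<in> L2_on E" "norm x = 1" "norm (mult_op \<phi> x) = m"
    using att by (auto simp: min_attaining_on_def m_def)
  then have m: "0 \<le> m" using norm_ge_zero by metis
  define F where "F = {z \<in> space circle. z \<in> E \<and> cmod (\<phi> z) < m}"
  have F: "F \<in> sets circle" unfolding F_def by measurable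
  have "measure circle F = 0"
  proof (rule ccontr)
    assume "measure circle F \<noteq> 0"
    then have "0 < measure circle F" by (simp add: zero_less_measure_iff)
    then obtain y where y: "y \<in> L2_on E" "norm y = 1"
        "AE z in circle. z \<notin> F \<longrightarrow> rep_L2 y z = 0"
        "AE z in circle. z \<in> F \<longrightarrow> rep_L2 y z \<noteq> 0"
      using L2_on_unit_vector[OF F _ E] unfolding F_def by blast
    \<comment> \<open>On \<open>F\<close> the first factor is negative and off \<open>F\<close> the
      vector \<open>y\<close> vanishes, so the integral is at most 0, while minimality of
      \<open>m\<close> makes it at least 0. Hence \<open>?d\<close> vanishes almost everywhere,
      which forces \<open>F\<close> to be null. The negated integrand is used to have a nonnegative
      one.\<close>
    let ?d = "\<lambda>z. ((cmod (\<phi> z))\<^sup>2 - m\<^sup>2) * (cmod (rep_L2 y z))\<^sup>2"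
    have F_less: "(cmod (\<phi> z))\<^sup>2 - m\<^sup>2 < 0" if "z \<in> F" for z
      using that by (auto simp: F_def intro!: power_strict_mono)
    have nonpos: "AE z in circle. 0 \<le> - ?d z"
      using y(3) by eventually_elim (use F_less in \<open>force intro: mult_nonpos_nonneg\<close>)
    have "m \<le> norm (mult_op \<phi> y)"
      unfolding m_def by (rule min_modulus_on_le[OF y(1,2)])
    then have "m\<^sup>2 \<le> (norm (mult_op \<phi> y))\<^sup>2"
      using m by (intro power_mono)
    then have "(\<integral>z. - ?d z \<partial>circle) \<le> 0"
      by (simp only: Bochner_Integration.integral_minus norm_mult_op_diff(2)[OF \<phi>]) (simp add: y)
    then have "(\<integral>z. - ?d z \<partial>circle) = 0"
      using integral_nonneg_AE[OF nonpos] by linarith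
    then have "AE z in circle. - ?d z = 0"
      using integral_nonneg_eq_0_iff_AE[OF integrable_minus[OF norm_mult_op_diff(1)[OF \<phi>]] nonpos]
      by simp
    then have "AE z in circle. z \<notin> F"
      using y(4) by eventually_elim (use F_less in force)
    then have "measure circle F = 0"
      using F circle.prob_eq_0 by blast
    with \<open>measure circle F \<noteq> 0\<close> show False ..
  qed
  then have "AE z in circle. z \<notin> F"
    using F circle.prob_eq_0 by blast
  then have ge: "AE z in circle. z \<in> E \<longrightarrow> m \<le> cmod (\<phi> z)"
    using AE_space by eventually_elim (auto simp: F_def)
  let ?d = "\<lambda>z. ((cmod (\<phi> z))\<^sup>2 - m\<^sup>2) * (cmod (rep_L2 x z))\<^sup>2"
  have nonneg: "AE z in circle. 0 \<le> ?d z"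
    using ge L2_onD[OF E x(1)]
  proof eventually_elim
    case (elim z)
    show ?case
      using elim power_mono[of m "cmod (\<phi> z)" 2] m by (cases "z \<in> E") auto
  qed
  \<comment> \<open>Both terms of \<open>norm_mult_op_diff\<close> equal \<open>m\<^sup>2\<close>,
    because \<open>x\<close> is a minimiser of norm 1.\<close>
  have "(\<integral>z. ?d z \<partial>circle) = 0"
    by (simp add: norm_mult_op_diff(2)[OF \<phi>] x)
  then have d0: "AE z in circle. ?d z = 0"
    using integral_nonneg_eq_0_iff_AE[OF norm_mult_op_diff(1)[OF \<phi>] nonneg] by simp
  have "\<not> (AE z in circle. z \<in> E \<longrightarrow> cmod (\<phi> z) \<noteq> m)"
  proof
    assume "AE z in circle. z \<in> E \<longrightarrow> cmod (\<phi> z) \<noteq> m"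
    with d0 L2_onD[OF E x(1)] have "AE z in circle. rep_L2 x z = 0"
      by eventually_elim (use m in \<open>auto simp: power2_eq_iff_nonneg\<close>)
    then show False using x(2) by (simp add: L2_eq_zero_iff[symmetric])
  qed
  with ge show thesis by (rule that)
qed

text \<open>For a set \<open>E\<close> of positive measure, \<open>L2_on E\<close> is a nonzero
  closed reducing subspace, so (i) applies to it.\<close>

lemma Mr_level_sets:
  assumes \<phi>: "\<phi> \<in> Linf" and Mr: "mult_op \<phi> \<in> \<M>\<^sub>r"
    and E: "E \<in> sets circle" "\<not> (AE z in circle. z \<notin> E)"
  obtains m where "AE z in circle. z \<in> E \<longrightarrow> m \<le> cmod (\<phi> z)"
    "\<not> (AE z in circle. z \<in> E \<longrightarrow> cmod (\<phi> z) \<noteq> m)"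
proof -
  have "0 < measure circle E"
    using E circle.prob_eq_0 by (metis zero_less_measure_iff)
  then obtain y where "y \<in> L2_on E" "norm y = 1"
    using L2_on_unit_vector[OF E(1) order_refl E(1)] by blast
  then have "L2_on E \<noteq> {0}" by (metis norm_zero singletonD zero_neq_one)
  then have "min_attaining_on (L2_on E) (mult_op \<phi>)"
    using Mr csubspace_L2_on[OF E(1)] closed_L2_on[OF E(1)] reduces_L2_on[OF E(1) \<phi>]
    by (auto simp: reducing_min_attaining_def)
  then show thesis
    using min_attaining_on_L2_on[OF \<phi> E(1)] that by blast
qed

text \<open>At almost every point only one level set contributes, so the sum over \<Lambda> is
  evaluated there without a convergence argument.\<close>

lemma infsum_single_level:
  fixes f :: "'a \<Rightarrow> complex"
  assumes "l \<in> \<Lambda>" "\<And>k. k \<in> \<Lambda> \<Longrightarrow> k \<noteq> l \<Longrightarrow> f k = 0"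
  shows "(\<Sum>\<^sub>\<infinity>k\<in>\<Lambda>. f k) = f l"
proof -
  have "(\<Sum>\<^sub>\<infinity>k\<in>\<Lambda>. f k) = (\<Sum>\<^sub>\<infinity>k\<in>{l}. f k)"
    by (rule infsum_cong_neutral) (use assms in auto)
  then show ?thesis by simp
qed

theorem theorem6p8:
  fixes \<phi> :: "complex \<Rightarrow> complex"
  assumes "\<phi> \<in> Linf"
  shows "mult_op \<phi> \<in> \<M>\<^sub>r \<longleftrightarrow>
    (\<exists>(\<Lambda> :: real set) (E :: real \<Rightarrow> complex set) (\<omega> :: complex \<Rightarrow> complex).
       countable \<Lambda> \<and> \<Lambda> \<subseteq> {0..Linf_norm \<phi>} \<and>
       well_order_on \<Lambda> {(a, b). a \<in> \<Lambda> \<and> b \<in> \<Lambda> \<and> a \<le> b} \<and>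
       (\<forall>l\<in>\<Lambda>. E l \<in> sets circle \<and> emeasure circle (E l) > 0) \<and>
       pairwise (\<lambda>l m. essentially_disjoint (E l) (E m)) \<Lambda> \<and>
       emeasure circle (sphere 0 1 - (\<Union>l\<in>\<Lambda>. E l)) = 0 \<and>
       \<omega> \<in> Linf \<and> (AE z in circle. cmod (\<omega> z) = 1) \<and>
       (AE z in circle. \<phi> z = \<omega> z * (\<Sum>\<^sub>\<infinity>l\<in>\<Lambda>. complex_of_real l * indicator (E l) z)))" (is "_ \<longleftrightarrow> ?rhs")
proof

  \<comment> \<open>From minimum attainment to the decomposition into level sets\<close>
  assume Mr: "mult_op \<phi> \<in> \<M>\<^sub>r"
  have [measurable]: "\<phi> \<in> borel_measurable circle"
    by (rule Linf_measurable[OF assms])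
  define E where "E l = {z \<in> space circle. cmod (\<phi> z) = l}" for l
  define \<Lambda> where "\<Lambda> = {l. measure circle (E l) \<noteq> 0}"
  \<comment> \<open>The default 1 at zeros of \<phi> keeps \<omega> unimodular everywhere; the
    product is still right there because the sum is 0.\<close>
  define \<omega> where "\<omega> z = (if \<phi> z = 0 then 1 else \<phi> z / complex_of_real (cmod (\<phi> z)))" for z
  have E_sets: "E l \<in> sets circle" for l
    unfolding E_def by measurable
  have in_\<Lambda>: "l \<in> \<Lambda>" if "\<not> (AE z in circle. z \<notin> E l)" for l
    using that E_sets circle.prob_eq_0 by (auto simp: \<Lambda>_def)
  have not_AE: "\<not> (AE z in circle. z \<notin> E l)" if "l \<in> \<Lambda>" for l
    using that E_sets circle.prob_eq_0 by (auto simp: \<Lambda>_def)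
  \<comment> \<open>\<Lambda> is the set of atoms of the distribution of
    \<open>cmod (\<phi> z)\<close>, and a probability measure has only countably many.\<close>
  have count: "countable \<Lambda>"
  proof -
    have meas: "(\<lambda>z. cmod (\<phi> z)) \<in> borel_measurable circle"
      by (rule measurable_compose[OF Linf_measurable[OF assms] borel_measurable_norm])
    interpret D: prob_space "distr circle borel (\<lambda>z. cmod (\<phi> z))"
      by (rule circle.prob_space_distr[OF meas])
    have "measure (distr circle borel (\<lambda>z. cmod (\<phi> z))) {l} = measure circle (E l)" for l
      by (subst measure_distr[OF meas])
         (auto simp: E_def vimage_def Int_def conj_commute intro: arg_cong[where f = "measure circle"])
    then show ?thesis
      using D.countable_support by (simp add: \<Lambda>_def)
  qed
  have Un_sets: "(\<Union>l\<in>S. E l) \<in> sets circle" if "S \<subseteq> \<Lambda>" for S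
    using countable_subset[OF that count] E_sets by (intro sets.countable_UN') auto
  have bounds: "\<Lambda> \<subseteq> {0..Linf_norm \<phi>}"
  proof
    fix l assume l: "l \<in> \<Lambda>"
    show "l \<in> {0..Linf_norm \<phi>}"
    proof (rule ccontr)
      assume l': "l \<notin> {0..Linf_norm \<phi>}"
      have "AE z in circle. z \<notin> E l"
        using Linf_AE_le[OF assms]
        by eventually_elim (use l' in \<open>auto simp: E_def\<close>)
      with not_AE[OF l] show False ..
    qed
  qed
  \<comment> \<open>On the union of the levels in \<open>S\<close> the modulus of \<phi> takes only
    values in \<open>S\<close>, so the essential infimum attained there belongs to \<open>S\<close>.
    Every level in \<open>S\<close> has positive measure, so none lies below it.\<close>
  have least: "\<exists>m\<in>S. \<forall>l\<in>S. m \<le> l" if S: "S \<subseteq> \<Lambda>" "S \<noteq> {}" for S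
  proof -
    let ?U = "\<Union>l\<in>S. E l"
    have U: "\<not> (AE z in circle. z \<notin> ?U)"
    proof
      assume U: "AE z in circle. z \<notin> ?U"
      obtain l where "l \<in> S" using S by blast
      have "AE z in circle. z \<notin> E l"
        using U by eventually_elim (use \<open>l \<in> S\<close> in blast)
      with not_AE[of l] \<open>l \<in> S\<close> S show False by blast
    qed
    obtain m where m: "AE z in circle. z \<in> ?U \<longrightarrow> m \<le> cmod (\<phi> z)"
        "\<not> (AE z in circle. z \<in> ?U \<longrightarrow> cmod (\<phi> z) \<noteq> m)"
      by (rule Mr_level_sets[OF assms Mr Un_sets[OF S(1)] U])
    have "m \<in> S"
    proof (rule ccontr)
      assume "m \<notin> S"
      then have "AE z in circle. z \<in> ?U \<longrightarrow> cmod (\<phi> z) \<noteq> m"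
        by (auto simp: E_def)
      with m show False by blast
    qed
    moreover have "m \<le> l" if "l \<in> S" for l
    proof (rule ccontr)
      assume less: "\<not> m \<le> l"
      have "AE z in circle. z \<notin> E l"
        using m(1) by eventually_elim (use that less in \<open>auto simp: E_def\<close>)
      with not_AE[of l] that S show False by blast
    qed
    ultimately show ?thesis by blast
  qed
  have R_sets: "sphere 0 1 - (\<Union>l\<in>\<Lambda>. E l) \<in> sets circle"
    using Un_sets[OF order_refl] by (metis sets.compl_sets space_circle)
  \<comment> \<open>If the rest had positive measure, \<open>cmod (\<phi> z)\<close> would equal
    some \<open>m\<close> on a non-null part of it. Then \<open>m\<close> would be in \<Lambda>,
    whose level sets have been removed.\<close>
  have cover: "AE z in circle. z \<notin> sphere 0 1 - (\<Union>l\<in>\<Lambda>. E l)" (is "AE z in circle. z \<notin> ?R")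
  proof (rule ccontr)
    assume "\<not> (AE z in circle. z \<notin> ?R)"
    then obtain m where m: "\<not> (AE z in circle. z \<in> ?R \<longrightarrow> cmod (\<phi> z) \<noteq> m)"
      using Mr_level_sets[OF assms Mr R_sets] by blast
    have "m \<in> \<Lambda>"
    proof (rule in_\<Lambda>, rule notI)
      assume "AE z in circle. z \<notin> E m"
      then have "AE z in circle. z \<in> ?R \<longrightarrow> cmod (\<phi> z) \<noteq> m"
        using AE_space by eventually_elim (auto simp: E_def)
      with m show False ..
    qed
    moreover have "AE z in circle. z \<in> ?R \<longrightarrow> cmod (\<phi> z) \<noteq> m" if "m \<in> \<Lambda>"
      using AE_space by eventually_elim (use that in \<open>auto simp: E_def\<close>)
    ultimately show False using m by blast
  qed
  have "emeasure circle ?R = 0"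
    using cover R_sets circle.prob_eq_0 by (simp add: circle.emeasure_eq_measure)
  moreover have \<omega>1: "cmod (\<omega> z) = 1" for z
    by (simp add: \<omega>_def norm_divide)
  moreover have "\<omega> \<in> Linf"
    by (rule LinfI[where C = 1]) (auto simp: \<omega>1, unfold \<omega>_def, measurable)
  moreover have "AE z in circle. \<phi> z = \<omega> z * (\<Sum>\<^sub>\<infinity>l\<in>\<Lambda>. complex_of_real l * indicator (E l) z)"
    using cover AE_space
  proof eventually_elim
    case (elim z)
    then have z: "cmod (\<phi> z) \<in> \<Lambda>" "z \<in> E (cmod (\<phi> z))"
      by (auto simp: E_def space_circle)
    have "(\<Sum>\<^sub>\<infinity>l\<in>\<Lambda>. complex_of_real l * indicator (E l) z) = complex_of_real (cmod (\<phi> z))"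
      using infsum_single_level[OF z(1), of "\<lambda>l. complex_of_real l * indicator (E l) z"] z(2)
      by (auto simp: E_def)
    then show ?case by (simp add: \<omega>_def)
  qed
  moreover have "E l \<in> sets circle \<and> emeasure circle (E l) > 0" if "l \<in> \<Lambda>" for l
    using that by (simp add: \<Lambda>_def E_sets circle.emeasure_eq_measure zero_less_measure_iff)
  moreover have "pairwise (\<lambda>l m. essentially_disjoint (E l) (E m)) \<Lambda>"
  proof -
    have "E l \<inter> E m = {}" if "l \<noteq> m" for l m using that by (auto simp: E_def)
    then show ?thesis by (auto simp: pairwise_def essentially_disjoint_def)
  qed
  moreover have "well_order_on \<Lambda> {(a, b). a \<in> \<Lambda> \<and> b \<in> \<Lambda> \<and> a \<le> b}"
    using least by (auto simp: well_order_on_real_iff)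
  ultimately show ?rhs
    using count bounds by (intro exI[of _ \<Lambda>] exI[of _ E] exI[of _ \<omega>]) auto
next

  \<comment> \<open>From the decomposition to minimum attainment\<close>
  assume ?rhs
  then obtain \<Lambda> E \<omega> where count: "countable \<Lambda>" and bounds: "\<Lambda> \<subseteq> {0..Linf_norm \<phi>}"
    and wo: "well_order_on \<Lambda> {(a, b). a \<in> \<Lambda> \<and> b \<in> \<Lambda> \<and> a \<le> b}"
    and E: "\<forall>l\<in>\<Lambda>. E l \<in> sets circle \<and> emeasure circle (E l) > 0"
    and disj: "pairwise (\<lambda>l m. essentially_disjoint (E l) (E m)) \<Lambda>"
    and cover: "emeasure circle (sphere 0 1 - (\<Union>l\<in>\<Lambda>. E l)) = 0"
    and \<omega>: "AE z in circle. cmod (\<omega> z) = 1"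
    and \<phi>_eq: "AE z in circle. \<phi> z = \<omega> z * (\<Sum>\<^sub>\<infinity>l\<in>\<Lambda>. complex_of_real l * indicator (E l) z)"
    by (elim exE conjE) (rule that; assumption)
  have "(\<Union>l\<in>\<Lambda>. E l) \<in> sets circle"
    using E count by (intro sets.countable_UN') auto
  then have "sphere 0 1 - (\<Union>l\<in>\<Lambda>. E l) \<in> null_sets circle"
    using cover by (metis null_setsI sets.compl_sets space_circle)
  from AE_not_in[OF this] AE_space have cover': "AE z in circle. z \<in> (\<Union>l\<in>\<Lambda>. E l)"
    by eventually_elim (simp add: space_circle)
  \<comment> \<open>Disjointness holds up to a null set for each pair. With
    \<open>l \<noteq> k\<close> inside the almost everywhere quantifier, countability of \<Lambda>
    yields a single null set for all pairs.\<close>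
  have "\<forall>l\<in>\<Lambda>. \<forall>k\<in>\<Lambda>. AE z in circle. l \<noteq> k \<longrightarrow> z \<notin> E l \<inter> E k"
  proof (intro ballI)
    fix l k assume lk: "l \<in> \<Lambda>" "k \<in> \<Lambda>"
    show "AE z in circle. l \<noteq> k \<longrightarrow> z \<notin> E l \<inter> E k"
    proof (cases "l = k")
      case False
      then have "E l \<inter> E k \<in> null_sets circle"
        using lk E disj by (intro null_setsI) (auto simp: pairwise_def essentially_disjoint_def)
      then have "AE z in circle. z \<notin> E l \<inter> E k" by (rule AE_not_in)
      then show ?thesis by eventually_elim simp
    qed simp
  qed
  then have "AE z in circle. \<forall>l\<in>\<Lambda>. \<forall>k\<in>\<Lambda>. l \<noteq> k \<longrightarrow> z \<notin> E l \<inter> E k"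
    by (simp only: AE_ball_countable[OF count])
  then have "AE z in circle. cmod (\<phi> z) \<in> \<Lambda>"
    using cover' \<omega> \<phi>_eq
  proof eventually_elim
    case (elim z)
    then obtain l where l: "l \<in> \<Lambda>" "z \<in> E l" by blast
    have "(\<Sum>\<^sub>\<infinity>k\<in>\<Lambda>. complex_of_real k * indicator (E k) z) = complex_of_real l"
      using infsum_single_level[OF l(1), of "\<lambda>k. complex_of_real k * indicator (E k) z"] l elim(1)
      by (auto simp: indicator_def)
    \<comment> \<open>The sign matters: the modulus of \<phi> at \<open>z\<close> is the absolute
      value of \<open>l\<close>.\<close>
    moreover have "0 \<le> l" using l bounds by auto
    ultimately have "cmod (\<phi> z) = l"
      unfolding elim(4) norm_mult elim(3) by simp
    with l show ?case by simp
  qed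
  then show "mult_op \<phi> \<in> \<M>\<^sub>r"
    using wo by (intro mult_op_in_Mr[OF assms count bounds]) (auto simp: well_order_on_real_iff)
qed

end
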